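(* Let $L\in\mathbb{R}^{n\times n}$ be symmetric positive-definite, $0<\tau_1<\tau_2$, $c\ge0$, and let $U$, $s$, $\mu$, $\mathcal{L}^c$ and the Dirichlet form $\mathcal{E}^c$ be as defined in the context. Then for any fixed function $f=f(x,y)$ in the domain of $\mathcal{L}^c$ (twice-differentiable with compact support on $\mathbb{R}^n\times\mathbb{R}^n$), $$\begin{aligned}\mathcal{E}^c(f)={}&\int\Big(\tau_1\big\|\sqrt{L}\,\nabla_xf(x,y)\big\|^2+\tau_2\big\|\sqrt{L}\,\nabla_yf(x,y)\big\|^2\Big)\,d\mu(x,y)\\&+\int\frac{c}{2}\,s(x,y)\big(f(y,x)-f(x,y)\big)^2\,d\mu(x,y),\end{aligned}$$ where both integrals on the right-hand side are nonnegative (the first being $\mathcal{E}^0(f)$, the Dirichlet form without swapping, $c=0$).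
   Context: Energy function: $U(\xi)=\tfrac12(\xi-m)^TB^{-1}(\xi-m)+\psi(\xi)$ for $\xi\in\mathbb{R}^n$, where $m\in\mathbb{R}^n$, $B\in\mathbb{R}^{n\times n}$ is symmetric positive-definite, and $\psi(\xi)=\frac{n_d}{2}\log(2\pi\sigma_o^2)+\frac{\|\mathbf{d}-\mathbf{G}(\xi)\|_2^2}{2\sigma_o^2}$ for a forward map $\mathbf{G}:\mathbb{R}^n\to\mathbb{R}^{n_d}$ (such that $U$ is differentiable), fixed data $\mathbf{d}\in\mathbb{R}^{n_d}$ and $\sigma_o>0$. Swapping function: $s(x,y)=\min\{1,\exp(\tau_\delta(U(x)-U(y)))\}$ with $\tau_\delta=\frac1{\tau_1}-\frac1{\tau_2}$. Invariant distribution: $\mu$ is the probability measure on $\mathbb{R}^n\times\mathbb{R}^n$ with density $\pi(x,y)\propto\exp\big(-\frac{U(x)}{\tau_1}-\frac{U(y)}{\tau_2}\big)$. Generator of the replica exchange preconditioned Langevin diffusion: $$\begin{aligned}\mathcal{L}^c(f(x,y))={}&-[L\nabla_xU(x)]\cdot\nabla_xf(x,y)+\tau_1L:\nabla_x\nabla_xf(x,y)-[L\nabla_yU(y)]\cdot\nabla_yf(x,y)\\&+\tau_2L:\nabla_y\nabla_yf(x,y)+c\,s(x,y)(f(y,x)-f(x,y)),\end{aligned}$$ with domain the twice-differentiable functions of compact support, where $L:\nabla_x\nabla_xf=\sum_{i,j}L_{ij}\frac{\partial^2f}{\partial x_i\partial x_j}$ (similarly in $y$). Carré du champ operator: $\Gamma^c(f)=\frac12\big(\mathcal{L}^c(f^2)-2f\,\mathcal{L}^c(f)\big)$.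 Dirichlet form: $\mathcal{E}^c(f)=\int\Gamma^c(f)\,d\mu$. $\sqrt{L}$ is the symmetric positive-definite square root of $L$ and $\|\cdot\|$ is the Euclidean norm. *)

theory Defs
  imports "HOL-Analysis.Analysis"
begin

definition sym_pos_def :: "real^'n^'n \<Rightarrow> bool" where
  "sym_pos_def A \<longleftrightarrow> transpose A = A \<and> (\<forall>x. x \<noteq> 0 \<longrightarrow> 0 < x \<bullet> (A *v x))"

definition mat_sqrt :: "real^'n^'n \<Rightarrow> real^'n^'n" where
  "mat_sqrt A = (THE S. sym_pos_def S \<and> S ** S = A)"

definition partial :: "'n \<Rightarrow> (real^'n \<Rightarrow> real) \<Rightarrow> real^'n \<Rightarrow> real" where
  "partial i f x = deriv (\<lambda>t. f (x + t *\<^sub>R axis i 1)) 0"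

definition grad :: "(real^'n \<Rightarrow> real) \<Rightarrow> real^'n \<Rightarrow> real^'n" where
  "grad f x = (\<chi> i. partial i f x)"

definition contract_hessian :: "real^'n^'n \<Rightarrow> (real^'n \<Rightarrow> real) \<Rightarrow> real^'n \<Rightarrow> real" where
  "contract_hessian L f x = (\<Sum>i\<in>UNIV. \<Sum>j\<in>UNIV. L $ i $ j * partial i (partial j f) x)"

definition grad_x :: "((real^'n) \<times> (real^'n) \<Rightarrow> real) \<Rightarrow> (real^'n) \<times> (real^'n) \<Rightarrow> real^'n" where
  "grad_x f = (\<lambda>(x, y). grad (\<lambda>x'. f (x', y)) x)"

definition grad_y :: "((real^'n) \<times> (real^'n) \<Rightarrow> real) \<Rightarrow> (real^'n) \<times> (real^'n) \<Rightarrow> real^'n" where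
  "grad_y f = (\<lambda>(x, y). grad (\<lambda>y'. f (x, y')) y)"

definition energy ::
  "real^'n \<Rightarrow> real^'n^'n \<Rightarrow> real \<Rightarrow> real^'d \<Rightarrow> (real^'n \<Rightarrow> real^'d) \<Rightarrow> real^'n \<Rightarrow> real" where
  "energy m B \<sigma> d G \<xi> =
     1/2 * ((\<xi> - m) \<bullet> (matrix_inv B *v (\<xi> - m)))
     + (real CARD('d) / 2 * ln (2 * pi * \<sigma>\<^sup>2) + (norm (d - G \<xi>))\<^sup>2 / (2 * \<sigma>\<^sup>2))"

definition swap_rate :: "(real^'n \<Rightarrow> real) \<Rightarrow> real \<Rightarrow> real \<Rightarrow> (real^'n) \<times> (real^'n) \<Rightarrow> real" where
  "swap_rate U \<tau>1 \<tau>2 = (\<lambda>(x, y). min 1 (exp ((1/\<tau>1 - 1/\<tau>2) * (U x - U y))))"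

definition gibbs_weight :: "(real^'n \<Rightarrow> real) \<Rightarrow> real \<Rightarrow> real \<Rightarrow> (real^'n) \<times> (real^'n) \<Rightarrow> real" where
  "gibbs_weight U \<tau>1 \<tau>2 = (\<lambda>(x, y). exp (- U x / \<tau>1 - U y / \<tau>2))"

definition invariant_measure ::
  "(real^'n \<Rightarrow> real) \<Rightarrow> real \<Rightarrow> real \<Rightarrow> ((real^'n) \<times> (real^'n)) measure" where
  "invariant_measure U \<tau>1 \<tau>2 =
     density lborel (\<lambda>z. ennreal (gibbs_weight U \<tau>1 \<tau>2 z / (\<integral>w. gibbs_weight U \<tau>1 \<tau>2 w \<partial>lborel)))"

definition generator ::
  "real^'n^'n \<Rightarrow> (real^'n \<Rightarrow> real) \<Rightarrow> real \<Rightarrow> real \<Rightarrow> real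
    \<Rightarrow> ((real^'n) \<times> (real^'n) \<Rightarrow> real) \<Rightarrow> (real^'n) \<times> (real^'n) \<Rightarrow> real" where
  "generator L U \<tau>1 \<tau>2 c f = (\<lambda>(x, y).
     - ((L *v grad U x) \<bullet> grad_x f (x, y))
     + \<tau>1 * contract_hessian L (\<lambda>x'. f (x', y)) x
     - (L *v grad U y) \<bullet> grad_y f (x, y)
     + \<tau>2 * contract_hessian L (\<lambda>y'. f (x, y')) y
     + c * swap_rate U \<tau>1 \<tau>2 (x, y) * (f (y, x) - f (x, y)))"

text \<open>Twice differentiability is in the sense of Frechet; the second derivative need not be
  continuous.\<close>

definition twice_differentiable :: "('a::real_normed_vector \<Rightarrow> real) \<Rightarrow> bool" where
  "twice_differentiable f \<longleftrightarrow>
     (\<exists>f' :: 'a \<Rightarrow> 'a \<Rightarrow>\<^sub>L real.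
        (\<forall>z. (f has_derivative blinfun_apply (f' z)) (at z)) \<and> (\<forall>z. f' differentiable (at z)))"

definition generator_domain :: "((real^'n) \<times> (real^'n) \<Rightarrow> real) set" where
  "generator_domain = {f. twice_differentiable f \<and> compact (closure (support_on UNIV f))}"

definition carre_du_champ ::
  "real^'n^'n \<Rightarrow> (real^'n \<Rightarrow> real) \<Rightarrow> real \<Rightarrow> real \<Rightarrow> real
    \<Rightarrow> ((real^'n) \<times> (real^'n) \<Rightarrow> real) \<Rightarrow> (real^'n) \<times> (real^'n) \<Rightarrow> real" where
  "carre_du_champ L U \<tau>1 \<tau>2 c f z =
     1/2 * (generator L U \<tau>1 \<tau>2 c (\<lambda>w. (f w)\<^sup>2) z - 2 * f z * generator L U \<tau>1 \<tau>2 c f z)"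

definition dirichlet_form ::
  "real^'n^'n \<Rightarrow> (real^'n \<Rightarrow> real) \<Rightarrow> real \<Rightarrow> real \<Rightarrow> real
    \<Rightarrow> ((real^'n) \<times> (real^'n) \<Rightarrow> real) \<Rightarrow> real" where
  "dirichlet_form L U \<tau>1 \<tau>2 c f =
     (\<integral>z. carre_du_champ L U \<tau>1 \<tau>2 c f z \<partial>invariant_measure U \<tau>1 \<tau>2)"

end

(* The product rule gives, pointwise, Gamma^c(f) = tau1 (grad_x f . L grad_x f)
   + tau2 (grad_y f . L grad_y f) + (c/2) s (f(y,x) - f(x,y))^2, because the drift and the terms
   f * Hessian f cancel in L^c(f^2) - 2 f L^c(f), and v . L v = |sqrt(L) v|^2. Everything here is
   continuous with compact support and the Gibbs density is continuous, so the integrals split.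
   A divergent normalising integral has the junk value 0, hence density 0, and all integrals
   vanish. *)

theory Submission
  imports Defs
begin

section \<open>Spectral theorem for symmetric linear maps\<close>

text \<open>First-order condition at the minimum \<open>t = 0\<close>; it serves as the variational
  step for the Rayleigh quotient.\<close>

lemma quadratic_nonneg_imp_zero:
  fixes a b :: real
  assumes "\<And>t. 0 \<le> 2 * t * a + t\<^sup>2 * b" and "0 \<le> b"
  shows "a = 0"
proof -
  \<comment> \<open>The minimiser would be \<open>- a / b\<close>; \<open>b + 1\<close> avoids
    division by zero when \<open>b = 0\<close> and still makes the value nonpositive.\<close>
  define t where "t = - a / (b + 1)"
  have a: "a = - t * (b + 1)"
    using assms(2) by (simp add: t_def field_simps)
  have "0 \<le> 2 * t * a + t\<^sup>2 * b"
    by (rule assms(1))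
  also have "\<dots> = - (t\<^sup>2 * (b + 2))"
    by (simp add: a algebra_simps power2_eq_square)
  finally have "t\<^sup>2 * (b + 2) \<le> 0"
    by simp
  then have "t = 0"
    using assms(2) by (auto simp: mult_le_0_iff)
  then show ?thesis
    using a by simp
qed

text \<open>The eigenvector maximises the Rayleigh quotient over the unit sphere of \<open>V\<close>.\<close>

lemma symmetric_eigenvector_in_subspace:
  fixes f :: "'a::euclidean_space \<Rightarrow> 'a"
  assumes lin: "linear f" and sym: "\<And>x y. f x \<bullet> y = x \<bullet> f y"
    and V: "subspace V" and inv: "\<And>x. x \<in> V \<Longrightarrow> f x \<in> V" and "x0 \<in> V" "x0 \<noteq> 0"
  obtains v l where "v \<in> V" "norm v = 1" "f v = l *\<^sub>R v"
proof -
  interpret f: linear f by (rule lin)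
  let ?S = "V \<inter> sphere 0 1"
  have "compact ?S"
    by (simp add: V closed_Int_compact closed_subspace)
  moreover have "x0 /\<^sub>R norm x0 \<in> ?S"
    using assms by (auto simp: subspace_scale)
  then have "?S \<noteq> {}" by blast
  moreover have "continuous_on ?S (\<lambda>x. x \<bullet> f x)"
    by (intro continuous_intros linear_continuous_on lin)
       (simp add: lin linear_conv_bounded_linear[symmetric])
  ultimately obtain v where v: "v \<in> ?S" and max: "\<And>x. x \<in> ?S \<Longrightarrow> x \<bullet> f x \<le> v \<bullet> f v"
    using continuous_attains_sup[of ?S "\<lambda>x. x \<bullet> f x"] by blast
  define l where "l = v \<bullet> f v"
  \<comment> \<open>By maximality of \<open>l\<close>, the quadratic form of \<open>g\<close> is
    nonnegative on \<open>V\<close>, and it vanishes at \<open>v\<close>. The goal is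
    \<open>g v = 0\<close>.\<close>
  define g where "g = (\<lambda>x. l *\<^sub>R x - f x)"
  have nn: "0 \<le> x \<bullet> g x" if "x \<in> V" for x
  proof (cases "x = 0")
    case False
    then have "x /\<^sub>R norm x \<in> ?S"
      using that by (auto simp: V subspace_scale)
    from max[OF this] have "(x \<bullet> f x) / (norm x)\<^sup>2 \<le> l"
      by (simp add: f.scaleR l_def power2_eq_square divide_inverse mult_ac)
    then have "x \<bullet> f x \<le> l * (norm x)\<^sup>2"
      using False by (simp add: field_simps)
    then show ?thesis
      by (simp add: g_def inner_diff_right power2_norm_eq_inner)
  qed simp
  have gV: "g v \<in> V"
    using v by (simp add: g_def V inv subspace_diff subspace_scale)
  have "v \<bullet> v = 1"
    using v by (simp add: norm_eq_1)
  then have vg: "v \<bullet> g v = 0"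
    by (simp add: g_def inner_diff_right l_def)
  have sg: "v \<bullet> g w = w \<bullet> g v" for w
    using sym[of v w] by (simp add: g_def inner_diff_right inner_commute)
  \<comment> \<open>Perturbing \<open>v\<close> in the direction \<open>g v\<close> makes the linear
    coefficient twice the squared norm of \<open>g v\<close>, which must therefore vanish.\<close>
  have "0 \<le> 2 * t * (g v \<bullet> g v) + t\<^sup>2 * (g v \<bullet> g (g v))" for t
  proof -
    have "0 \<le> (v + t *\<^sub>R g v) \<bullet> g (v + t *\<^sub>R g v)"
      using nn v gV by (simp add: V subspace_add subspace_scale)
    also have "g (v + t *\<^sub>R g v) = g v + t *\<^sub>R g (g v)"
      by (simp add: g_def f.add f.diff f.scaleR algebra_simps)
    finally show ?thesis
      by (simp add: inner_add_left inner_add_right vg sg[of "g v"] power2_eq_square algebra_simps)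
  qed
  from quadratic_nonneg_imp_zero[OF this nn[OF gV]] have "f v = l *\<^sub>R v"
    by (simp add: g_def)
  with v show thesis
    by (intro that) auto
qed

text \<open>An orthonormal set of eigenvectors of greatest cardinality must span: by symmetry its
  orthogonal complement is invariant, and a nonzero vector there would produce one more
  eigenvector.\<close>

lemma symmetric_orthonormal_eigenbasis:
  fixes f :: "'a::euclidean_space \<Rightarrow> 'a"
  assumes lin: "linear f" and sym: "\<And>x y. f x \<bullet> y = x \<bullet> f y"
  obtains E l where "finite E" "pairwise orthogonal E" "\<And>v. v \<in> E \<Longrightarrow> norm v = 1"
    "\<And>v. v \<in> E \<Longrightarrow> f v = l v *\<^sub>R v" "span E = UNIV"
proof -
  interpret f: linear f by (rule lin)
  define P where "P E \<longleftrightarrow> pairwise orthogonal E \<and> (\<forall>v\<in>E. norm v = 1 \<and> (\<exists>l. f v = l *\<^sub>R v))"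
    for E
  \<comment> \<open>Unit norm excludes the zero vector, so orthogonality gives independence; the
    resulting bound is what makes a largest \<open>E\<close> exist.\<close>
  have bound: "finite E \<and> card E \<le> DIM('a)" if "P E" for E
    using that by (intro independent_bound pairwise_orthogonal_independent) (auto simp: P_def)
  have "P {}"
    by (simp add: P_def pairwise_def)
  moreover have "\<forall>E. P E \<longrightarrow> card E < Suc (DIM('a))"
    using bound by (auto simp: less_Suc_eq_le)
  ultimately obtain E where E: "P E" and max: "\<And>F. P F \<Longrightarrow> card F \<le> card E"
    using ex_has_greatest_nat[of P "{}" card] by blast
  define V where "V = {x. \<forall>v\<in>E. v \<bullet> x = 0}"
  have V: "subspace V"
    by (auto simp: V_def subspace_def inner_add_right)
  have inv: "f x \<in> V" if "x \<in> V" for x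
    unfolding V_def
  proof safe
    fix v assume "v \<in> E"
    then obtain l where "f v = l *\<^sub>R v"
      using E by (auto simp: P_def)
    moreover have "v \<bullet> x = 0"
      using that \<open>v \<in> E\<close> by (simp add: V_def)
    ultimately show "v \<bullet> f x = 0"
      by (simp add: sym[symmetric])
  qed
  have V0: "x = 0" if x: "x \<in> V" for x
  proof (rule ccontr)
    assume "x \<noteq> 0"
    then obtain v l where v: "v \<in> V" "norm v = 1" "f v = l *\<^sub>R v"
      using symmetric_eigenvector_in_subspace[OF lin sym V inv x] by metis
    have "P (insert v E)"
      using E v by (auto simp: P_def V_def pairwise_insert orthogonal_def inner_commute)
    moreover have "v \<notin> E"
      using v by (auto simp: V_def)
    ultimately show False
      using max[of "insert v E"] bound[OF E] by simp
  qed
  have "x \<in> span E" for x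
  proof -
    obtain y z where y: "y \<in> span E" and z: "\<And>w. w \<in> span E \<Longrightarrow> orthogonal z w" and x: "x = y + z"
      by (rule orthogonal_subspace_decomp_exists[of E x]) (rule that)
    have "z \<in> V"
      using z by (auto simp: V_def orthogonal_def inner_commute intro: span_base)
    with V0[of z] x y show ?thesis by simp
  qed
  moreover obtain l where "\<And>v. v \<in> E \<Longrightarrow> f v = l v *\<^sub>R v"
    using E unfolding P_def by metis
  ultimately show thesis
    using E bound[OF E] by (intro that) (auto simp: P_def)
qed

section \<open>The positive definite square root of a matrix\<close>

lemma sym_pos_def_inner:
  "sym_pos_def A \<Longrightarrow> (A *v x) \<bullet> y = x \<bullet> (A *v y)"
  by (metis dot_lmul_matrix sym_pos_def_def vector_transpose_matrix)

text \<open>In an orthonormal eigenbasis it suffices to replace each eigenvalue, positive by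
  definiteness, by its square root.\<close>

lemma sym_pos_def_sqrt_exists:
  fixes A :: "real^'n^'n"
  assumes A: "sym_pos_def A"
  obtains S where "sym_pos_def S" "S ** S = A"
proof -
  obtain E l where E: "finite E" "pairwise orthogonal E" "\<And>v. v \<in> E \<Longrightarrow> norm v = 1"
    and l: "\<And>v. v \<in> E \<Longrightarrow> A *v v = l v *\<^sub>R v" and span: "span E = UNIV"
    by (rule symmetric_orthonormal_eigenbasis[OF matrix_vector_mul_linear sym_pos_def_inner[OF A]])
      (rule that)
  have pos: "0 < l v" if "v \<in> E" for v
  proof -
    have "0 < v \<bullet> (A *v v)"
      using A E(3)[OF that] by (metis norm_zero sym_pos_def_def zero_neq_one)
    then show ?thesis
      using E(3)[OF that] by (simp add: l[OF that] norm_eq_1)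
  qed
  define S where "S = (\<lambda>x. \<Sum>v\<in>E. (sqrt (l v) * (x \<bullet> v)) *\<^sub>R v)"
  have lin: "linear S"
    unfolding S_def
    by (intro linearI) (simp_all add: inner_add_left algebra_simps sum.distrib scaleR_sum_right)
  have S_eigen: "S v = sqrt (l v) *\<^sub>R v" if "v \<in> E" for v
  proof -
    have "S v = (\<Sum>w\<in>E. if w = v then sqrt (l v) *\<^sub>R v else 0)"
      unfolding S_def
      using E(2,3) that by (intro sum.cong) (auto simp: pairwise_def orthogonal_def norm_eq_1)
    then show ?thesis
      using that E(1) by simp
  qed
  have S_sym: "S x \<bullet> y = x \<bullet> S y" for x y
    by (simp add: S_def inner_sum_left inner_sum_right inner_commute mult_ac)
  have S_pos: "0 < x \<bullet> S x" if x: "x \<noteq> 0" for x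
  proof -
    \<comment> \<open>A nonzero \<open>x\<close> has a nonzero coordinate, and this one contributes
      a strictly positive term to a sum of nonnegative ones.\<close>
    have "(\<Sum>v\<in>E. (x \<bullet> v) *\<^sub>R v) = x"
      using E span by (intro orthonormal_basis_expand) auto
    then obtain v where "v \<in> E" "x \<bullet> v \<noteq> 0"
      using x by (metis (no_types, lifting) scale_zero_left sum.neutral)
    then have "0 < (\<Sum>v\<in>E. sqrt (l v) * (x \<bullet> v)\<^sup>2)"
      using E(1) pos by (intro sum_pos2[of _ v]) (auto simp: less_imp_le)
    then show ?thesis
      by (simp add: S_def inner_sum_right power2_eq_square mult_ac)
  qed
  have matS: "matrix S *v x = S x" for x
    using matrix_vector_mul(2)[OF lin] by metis
  have "S (S x) = A *v x" for x
  proof (rule linear_eq_on_span[of "\<lambda>x. S (S x)" "(*v) A" E])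
    show "linear (\<lambda>x. S (S x))"
      using linear_compose[OF lin lin] by (simp add: o_def)
    show "S (S v) = A *v v" if "v \<in> E" for v
      using that pos[OF that] by (simp add: S_eigen linear_scale[OF lin] l)
  qed (auto simp: span)
  then have "matrix S ** matrix S = A"
    by (simp add: matrix_eq matS matrix_vector_mul_assoc[symmetric])
  \<comment> \<open>The transpose represents the adjoint, and \<open>S\<close> is its own adjoint by
    \<open>S_sym\<close>.\<close>
  moreover have "transpose (matrix S) = matrix S"
    using adjoint_unique[of S S] S_sym by (simp add: matrix_adjoint[OF lin, symmetric])
  ultimately show thesis
    using S_pos by (intro that[of "matrix S"]) (auto simp: sym_pos_def_def matS)
qed

text \<open>\<open>(T + s)(T - s) v = 0\<close> for every eigenpair \<open>(v, s)\<close> of \<open>S\<close>, and \<open>T + s\<close> is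
  positive definite, so \<open>T v = s v\<close>: the two roots agree on an eigenbasis of \<open>S\<close>.\<close>

lemma sym_pos_def_sqrt_unique:
  fixes S T :: "real^'n^'n"
  assumes S: "sym_pos_def S" and T: "sym_pos_def T" and eq: "S ** S = T ** T"
  shows "S = T"
proof -
  obtain E l where "finite E" "pairwise orthogonal E" and E: "\<And>v. v \<in> E \<Longrightarrow> norm v = 1"
    and l: "\<And>v. v \<in> E \<Longrightarrow> S *v v = l v *\<^sub>R v" and span: "span E = UNIV"
    by (rule symmetric_orthonormal_eigenbasis[OF matrix_vector_mul_linear sym_pos_def_inner[OF S]])
      (rule that)
  have agree: "S *v v = T *v v" if v: "v \<in> E" for v
  proof -
    have "0 < v \<bullet> (S *v v)"
      using S E[OF v] by (metis norm_zero sym_pos_def_def zero_neq_one)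
    then have pos: "0 < l v"
      using E[OF v] by (simp add: l[OF v] norm_eq_1)
    define w where "w = T *v v - l v *\<^sub>R v"
    have "T *v (T *v v) = l v *\<^sub>R (l v *\<^sub>R v)"
      by (metis eq l[OF v] matrix_vector_mul_assoc matrix_vector_mult_scaleR)
    then have "T *v w + l v *\<^sub>R w = 0"
      by (simp add: w_def matrix_vector_mult_diff_distrib matrix_vector_mult_scaleR algebra_simps)
    then have "w \<bullet> (T *v w) + l v * (w \<bullet> w) = 0"
      by (metis inner_add_right inner_scaleR_right inner_zero_right)
    moreover have "0 \<le> l v * (w \<bullet> w)"
      using pos by simp
    ultimately have "w = 0"
      using T by (force simp: sym_pos_def_def)
    then show ?thesis
      by (simp add: w_def l[OF v])
  qed
  have "S *v x = T *v x" for x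
    by (rule linear_eq_on_span[of "(*v) S" "(*v) T" E]) (auto simp: agree span)
  then show ?thesis
    by (simp add: matrix_eq)
qed

text \<open>Since \<open>mat_sqrt\<close> is a definite description, its properties become available
  only through existence and uniqueness together.\<close>

lemma mat_sqrt:
  assumes "sym_pos_def A"
  shows "sym_pos_def (mat_sqrt A)" "mat_sqrt A ** mat_sqrt A = A"
proof -
  have "\<exists>!S. sym_pos_def S \<and> S ** S = A"
    by (metis assms sym_pos_def_sqrt_exists sym_pos_def_sqrt_unique)
  from theI'[OF this] show "sym_pos_def (mat_sqrt A)" "mat_sqrt A ** mat_sqrt A = A"
    by (simp_all add: mat_sqrt_def)
qed

text \<open>Symmetry moves one root across the inner product, where the two roots multiply to
  \<open>A\<close>.\<close>

lemma norm_mat_sqrt_mult: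
  assumes "sym_pos_def A"
  shows "(norm (mat_sqrt A *v v))\<^sup>2 = v \<bullet> (A *v v)"
  by (simp add: power2_norm_eq_inner sym_pos_def_inner mat_sqrt[OF assms] matrix_vector_mul_assoc)

section \<open>Partial derivatives and the product rule\<close>

text \<open>Chain rule along the coordinate line through \<open>x\<close>; it replaces
  \<open>deriv\<close> by the Frechet derivative, for which the usual calculus rules apply.\<close>

lemma partial_eq_derivative:
  assumes "(f has_derivative f') (at x)"
  shows "partial i f x = f' (axis i 1)"
proof -
  \<comment> \<open>The base point is written as the value of the line at \<open>t = 0\<close>, the
    form that the chain rule expects.\<close>
  have "(f has_derivative f') (at (x + 0 *\<^sub>R axis i 1))"
    using assms by simp
  then have "((\<lambda>t. f (x + t *\<^sub>R axis i 1)) has_derivative (\<lambda>t. f' (t *\<^sub>R axis i 1))) (at 0)"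
    by (rule has_derivative_compose[rotated]) (auto intro!: derivative_eq_intros)
  also have "(\<lambda>t. f' (t *\<^sub>R axis i 1)) = (*) (f' (axis i 1))"
    by (simp add: linear_scale[OF has_derivative_linear[OF assms]] fun_eq_iff)
  finally have "((\<lambda>t. f (x + t *\<^sub>R axis i 1)) has_real_derivative f' (axis i 1)) (at 0)"
    by (simp add: has_field_derivative_def)
  then show ?thesis
    by (simp add: partial_def DERIV_imp_deriv)
qed

lemma partial_mult:
  assumes "f differentiable at x" "g differentiable at x"
  shows "partial i (\<lambda>x. f x * g x) x = partial i f x * g x + f x * partial i g x"
proof -
  obtain f' g' where d: "(f has_derivative f') (at x)" "(g has_derivative g') (at x)"
    using assms by (auto simp: differentiable_def)
  show ?thesis
    by (simp add: partial_eq_derivative[OF has_derivative_mult[OF d]]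
        partial_eq_derivative[OF d(1)] partial_eq_derivative[OF d(2)])
qed

lemma grad_square:
  assumes "f differentiable at x"
  shows "grad (\<lambda>x. (f x)\<^sup>2) x = (2 * f x) *\<^sub>R grad f x"
  by (simp add: grad_def power2_eq_square partial_mult assms vec_eq_iff)

text \<open>Two applications of the product rule: besides \<open>f\<close> times its second
  derivatives, products of first derivatives appear, and contracting these with \<open>L\<close>
  gives the quadratic form.\<close>

lemma contract_hessian_square:
  fixes f :: "real^'n \<Rightarrow> real"
  assumes "\<And>x. f differentiable at x" and "\<And>j. partial j f differentiable at x"
  shows "contract_hessian L (\<lambda>x. (f x)\<^sup>2) x
    = 2 * f x * contract_hessian L f x + 2 * (grad f x \<bullet> (L *v grad f x))"
proof -
  have 1: "partial j (\<lambda>x. (f x)\<^sup>2) = (\<lambda>x. f x * partial j f x + f x * partial j f x)" for j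
    by (simp add: power2_eq_square partial_mult assms fun_eq_iff)
  \<comment> \<open>The sum is treated as the single product of \<open>2 * f\<close> with
    \<open>partial j f\<close>; the factor 2 is again handled by the product rule.\<close>
  have 2: "partial i (\<lambda>x. f x * partial j f x + f x * partial j f x) x
    = 2 * (f x * partial i (partial j f) x) + 2 * (partial i f x * partial j f x)" for i j
    using partial_mult[of "\<lambda>x. 2 * f x" x "partial j f" i] partial_mult[of "\<lambda>_. 2" x f i] assms
    by (simp add: partial_def algebra_simps)
  show ?thesis
    unfolding contract_hessian_def 1 2
    by (simp add: grad_def inner_vec_def matrix_vector_mult_def algebra_simps sum.distrib
        sum_distrib_left)
qed

section \<open>Integrability against a continuous density\<close>

text \<open>The product \<open>w * g\<close> equals its own restriction to \<open>K\<close>, and a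
  continuous function on a compact set is integrable.\<close>

lemma continuous_compact_support_integrable_density:
  fixes w g :: "'a::euclidean_space \<Rightarrow> real"
  assumes w: "continuous_on UNIV w" "\<And>x. 0 \<le> w x" and g: "continuous_on UNIV g"
    and K: "compact K" "\<And>x. x \<notin> K \<Longrightarrow> g x = 0"
  shows "integrable (density lborel (\<lambda>x. ennreal (w x))) g"
proof -
  have "(\<lambda>x. w x * g x) = (\<lambda>x. indicator K x *\<^sub>R (w x * g x))"
    using K(2) by (auto simp: fun_eq_iff indicator_def)
  moreover have "integrable lborel (\<lambda>x. indicator K x *\<^sub>R (w x * g x))"
    using K(1) w(1) g
    by (intro borel_integrable_compact continuous_intros) (auto intro: continuous_on_subset)
  ultimately have "integrable lborel (\<lambda>x. w x * g x)"
    by simp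
  then show ?thesis
    using w g by (subst integrable_density) (auto intro: borel_measurable_continuous_onI)
qed

section \<open>Slices, gradients and the carre du champ\<close>

text \<open>Fixes the witness of the existential in \<open>twice_differentiable\<close>, so that
  both gradients can be expressed through the one map \<open>f'\<close>.\<close>

locale twice_differentiable_pair =
  fixes f :: "(real^'n) \<times> (real^'n) \<Rightarrow> real"
    and f' :: "(real^'n) \<times> (real^'n) \<Rightarrow> ((real^'n) \<times> (real^'n)) \<Rightarrow>\<^sub>L real"
  assumes derivative: "\<And>z. (f has_derivative blinfun_apply (f' z)) (at z)"
    and derivative_differentiable: "\<And>z. f' differentiable at z"
begin

text \<open>Evaluation at a fixed vector is bounded linear, so it preserves
  differentiability.\<close>

lemma derivative_apply_differentiable: "(\<lambda>z. blinfun_apply (f' z) v) differentiable at z"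
proof -
  obtain D where "(f' has_derivative D) (at z)"
    using derivative_differentiable unfolding differentiable_def by blast
  from bounded_linear.has_derivative[OF blinfun.bounded_linear_left this]
  show ?thesis
    unfolding differentiable_def by blast
qed

lemma has_derivative_slice:
  "((\<lambda>x. f (x, y)) has_derivative (\<lambda>h. blinfun_apply (f' (x, y)) (h, 0))) (at x)"
  "((\<lambda>y. f (x, y)) has_derivative (\<lambda>h. blinfun_apply (f' (x, y)) (0, h))) (at y)"
  by (rule has_derivative_compose[OF _ derivative]; auto intro!: derivative_eq_intros)+

lemma partial_slice:
  "partial j (\<lambda>x. f (x, y)) = (\<lambda>x. blinfun_apply (f' (x, y)) (axis j 1, 0))"
  "partial j (\<lambda>y. f (x, y)) = (\<lambda>y. blinfun_apply (f' (x, y)) (0, axis j 1))"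
  by (simp_all add: fun_eq_iff partial_eq_derivative[OF has_derivative_slice(1)]
      partial_eq_derivative[OF has_derivative_slice(2)])

lemma slice_differentiable:
  "(\<lambda>x. f (x, y)) differentiable at x" "(\<lambda>y. f (x, y)) differentiable at y"
  using has_derivative_slice differentiable_def by blast+

lemma partial_slice_differentiable:
  "partial j (\<lambda>x. f (x, y)) differentiable at x" "partial j (\<lambda>y. f (x, y)) differentiable at y"
  unfolding partial_slice
  by (rule differentiable_compose[OF derivative_apply_differentiable];
      auto simp: differentiable_def intro!: exI derivative_eq_intros)+

lemma grad_slice:
  "grad_x f z = (\<chi> j. blinfun_apply (f' z) (axis j 1, 0))"
  "grad_y f z = (\<chi> j. blinfun_apply (f' z) (0, axis j 1))"
  by (cases z; simp add: grad_x_def grad_y_def grad_def partial_slice)+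

text \<open>First derivatives are continuous because \<open>f'\<close> is differentiable. Second
  derivatives may be discontinuous, but they cancel from the carre du champ.\<close>

lemma continuous_on_grad:
  "continuous_on UNIV (grad_x f)" "continuous_on UNIV (grad_y f)"
proof -
  have "continuous_on UNIV (\<lambda>z. blinfun_apply (f' z) v)" for v
    by (simp add: continuous_at_imp_continuous_on derivative_apply_differentiable
        differentiable_imp_continuous_within)
  then show "continuous_on UNIV (grad_x f)" "continuous_on UNIV (grad_y f)"
    by (simp_all add: grad_slice[abs_def] continuous_on_vec_lambda)
qed

lemma continuous: "continuous_on UNIV f"
  by (intro continuous_at_imp_continuous_on ballI has_derivative_continuous[OF derivative])

text \<open>The complement of the closed support is open, so \<open>f\<close> is zero near
  \<open>z\<close> and uniqueness of derivatives applies.\<close>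

lemma grad_eq_0_outside_support:
  assumes "z \<notin> closure (support_on UNIV f)"
  shows "grad_x f z = 0" "grad_y f z = 0"
proof -
  have "f w = 0" if "w \<in> - closure (support_on UNIV f)" for w
    using that closure_subset[of "support_on UNIV f"] by (auto simp: support_on_def)
  then have "((\<lambda>_. 0) has_derivative blinfun_apply (f' z)) (at z)"
    using assms
    by (intro has_derivative_transform_within_open[OF derivative,
          of "- closure (support_on UNIV f)"]) auto
  then have "blinfun_apply (f' z) = (\<lambda>_. 0)"
    by (rule has_derivative_unique) simp
  then show "grad_x f z = 0" "grad_y f z = 0"
    by (simp_all add: grad_slice vec_eq_iff)
qed

text \<open>The swap part rests on \<open>b^2 - a^2 - 2 * a * (b - a) = (b - a)^2\<close> with
  \<open>a = f (x, y)\<close> and \<open>b = f (y, x)\<close>.\<close>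

lemma carre_du_champ_eq:
  "carre_du_champ L U \<tau>1 \<tau>2 c f (x, y) =
    \<tau>1 * (grad_x f (x, y) \<bullet> (L *v grad_x f (x, y))) + \<tau>2 * (grad_y f (x, y) \<bullet> (L *v grad_y f (x, y)))
    + c / 2 * swap_rate U \<tau>1 \<tau>2 (x, y) * (f (y, x) - f (x, y))\<^sup>2"
proof -
  have "contract_hessian L (\<lambda>x'. (f (x', y))\<^sup>2) x = 2 * f (x, y) * contract_hessian L (\<lambda>x'. f (x', y)) x
      + 2 * (grad_x f (x, y) \<bullet> (L *v grad_x f (x, y)))"
    by (simp add: grad_x_def contract_hessian_square slice_differentiable
        partial_slice_differentiable)
  moreover have "contract_hessian L (\<lambda>y'. (f (x, y'))\<^sup>2) y
      = 2 * f (x, y) * contract_hessian L (\<lambda>y'. f (x, y')) y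
      + 2 * (grad_y f (x, y) \<bullet> (L *v grad_y f (x, y)))"
    by (simp add: grad_y_def contract_hessian_square slice_differentiable
        partial_slice_differentiable)
  moreover have "grad_x (\<lambda>w. (f w)\<^sup>2) (x, y) = (2 * f (x, y)) *\<^sub>R grad_x f (x, y)"
    by (simp add: grad_x_def grad_square slice_differentiable)
  moreover have "grad_y (\<lambda>w. (f w)\<^sup>2) (x, y) = (2 * f (x, y)) *\<^sub>R grad_y f (x, y)"
    by (simp add: grad_y_def grad_square slice_differentiable)
  ultimately show ?thesis
    by (simp add: carre_du_champ_def generator_def power2_eq_square field_simps)
qed

end

theorem theorem2p2:
  fixes m :: "real^'n" and B L :: "real^'n^'n"
    and d :: "real^'d" and G :: "real^'n \<Rightarrow> real^'d"
    and \<sigma> \<tau>1 \<tau>2 c :: real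
    and U :: "real^'n \<Rightarrow> real"
    and f :: "(real^'n) \<times> (real^'n) \<Rightarrow> real"
  assumes "sym_pos_def B" and "\<sigma> > 0"
    and "U = energy m B \<sigma> d G"
    and "\<forall>\<xi>. U differentiable (at \<xi>)"
    and "sym_pos_def L"
    and "0 < \<tau>1" and "\<tau>1 < \<tau>2" and "c \<ge> 0"
    and "f \<in> generator_domain"
  shows "let \<mu> = invariant_measure U \<tau>1 \<tau>2;
             g = (\<lambda>z. \<tau>1 * (norm (mat_sqrt L *v grad_x f z))\<^sup>2
                    + \<tau>2 * (norm (mat_sqrt L *v grad_y f z))\<^sup>2);
             h = (\<lambda>(x, y). c / 2 * swap_rate U \<tau>1 \<tau>2 (x, y) * (f (y, x) - f (x, y))\<^sup>2)
         in integrable \<mu> (carre_du_champ L U \<tau>1 \<tau>2 c f) \<and> integrable \<mu> g \<and> integrable \<mu> h \<and>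
            dirichlet_form L U \<tau>1 \<tau>2 c f = (\<integral>z. g z \<partial>\<mu>) + (\<integral>z. h z \<partial>\<mu>) \<and>
            (\<integral>z. g z \<partial>\<mu>) \<ge> 0 \<and> (\<integral>z. h z \<partial>\<mu>) \<ge> 0 \<and>
            (\<integral>z. g z \<partial>\<mu>) = dirichlet_form L U \<tau>1 \<tau>2 0 f"
proof -
  obtain f' where "twice_differentiable_pair f f'"
    using assms(9)
    by (auto simp: generator_domain_def twice_differentiable_def twice_differentiable_pair_def)
  then interpret twice_differentiable_pair f f' .
  define \<mu> where "\<mu> = invariant_measure U \<tau>1 \<tau>2"
  define g where "g = (\<lambda>z. \<tau>1 * (norm (mat_sqrt L *v grad_x f z))\<^sup>2
                    + \<tau>2 * (norm (mat_sqrt L *v grad_y f z))\<^sup>2)"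
  define h where "h = (\<lambda>(x, y). c / 2 * swap_rate U \<tau>1 \<tau>2 (x, y) * (f (y, x) - f (x, y))\<^sup>2)"
  define K where "K = closure (support_on UNIV f)"
  have K: "compact K"
    using assms(9) by (simp add: K_def generator_domain_def)
  have f0: "f z = 0" if "z \<notin> K" for z
    using that closure_subset[of "support_on UNIV f"] by (auto simp: K_def support_on_def)
  \<comment> \<open>This yields continuity of both the Gibbs weight and the swap rate.\<close>
  have U: "continuous_on UNIV U"
    using assms(4) by (simp add: continuous_at_imp_continuous_on differentiable_imp_continuous_within)
  have U_compose: "continuous_on UNIV (\<lambda>z. U (p z))" if "continuous_on UNIV p"
    for p :: "(real^'n) \<times> (real^'n) \<Rightarrow> real^'n"
    using continuous_on_compose2[OF U that] by simp
  have weight: "continuous_on UNIV (gibbs_weight U \<tau>1 \<tau>2)" "0 \<le> gibbs_weight U \<tau>1 \<tau>2 z" for z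
    unfolding gibbs_weight_def case_prod_beta
    using assms(6,7) by (auto intro!: continuous_intros U_compose)
  have integrable_\<mu>: "integrable \<mu> k"
    if "continuous_on UNIV k" "compact C" "\<And>z. z \<notin> C \<Longrightarrow> k z = 0"
    for k :: "(real^'n) \<times> (real^'n) \<Rightarrow> real" and C
  proof -
    define Z where "Z = (\<integral>w. gibbs_weight U \<tau>1 \<tau>2 w \<partial>lborel)"
    have "0 \<le> Z"
      using weight(2) by (simp add: Z_def)
    \<comment> \<open>If \<open>Z = 0\<close>, division by zero makes the quotient the constant 0,
      which is still continuous.\<close>
    moreover have "continuous_on UNIV (\<lambda>z. gibbs_weight U \<tau>1 \<tau>2 z / Z)"
      by (cases "Z = 0") (auto intro!: continuous_intros weight)
    ultimately show ?thesis
      unfolding \<mu>_def invariant_measure_def Z_def[symmetric]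
      using weight(2) that(1,2)
      by (intro continuous_compact_support_integrable_density[OF _ _ _ _ that(3)]) simp_all
  qed
  have "continuous_on UNIV g"
    unfolding g_def
    by (intro continuous_intros continuous_on_grad
        bounded_linear.continuous_on[OF matrix_vector_mul_bounded_linear])
  moreover have "g z = 0" if "z \<notin> K" for z
    using that grad_eq_0_outside_support by (simp add: g_def K_def)
  ultimately have int_g: "integrable \<mu> g"
    using K by (intro integrable_\<mu>)
  have "continuous_on UNIV h"
    unfolding h_def swap_rate_def case_prod_beta fst_conv snd_conv
    by (intro continuous_intros U_compose continuous_on_compose2[OF continuous]) auto
  \<comment> \<open>Because \<open>h\<close> also evaluates \<open>f\<close> at the swapped point,
    its support may leave \<open>K\<close> and needs the mirror image of \<open>K\<close> as
    well.\<close>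
  moreover have "h z = 0" if "z \<notin> K \<union> prod.swap ` K" for z
  proof -
    have "z \<notin> K" "prod.swap z \<notin> K"
      using that by (auto simp: image_iff)
    then show ?thesis
      using f0[of z] f0[of "prod.swap z"] by (cases z) (simp add: h_def)
  qed
  moreover have "compact (K \<union> prod.swap ` K)"
    using K by (intro compact_Un compact_continuous_image continuous_intros continuous_on_swap)
  ultimately have int_h: "integrable \<mu> h"
    by (intro integrable_\<mu>)
  have carre_c: "carre_du_champ L U \<tau>1 \<tau>2 c f = (\<lambda>z. g z + h z)"
    by (auto simp: carre_du_champ_eq g_def h_def norm_mat_sqrt_mult[OF assms(5)])
  \<comment> \<open>At \<open>c = 0\<close> the swap term vanishes, which identifies the integral of
    \<open>g\<close> as the Dirichlet form without swapping.\<close>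
  have carre_0: "carre_du_champ L U \<tau>1 \<tau>2 0 f = g"
    by (auto simp: carre_du_champ_eq g_def norm_mat_sqrt_mult[OF assms(5)])
  have "0 \<le> g z" "0 \<le> h z" for z
    using assms(6-8) by (auto simp: g_def h_def swap_rate_def split: prod.split)
  then show ?thesis
    unfolding Let_def \<mu>_def[symmetric] g_def[symmetric] h_def[symmetric] dirichlet_form_def
    using int_g int_h by (simp add: carre_c carre_0)
qed

end
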